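(* Let $p$ be a natural number. If $\Omega\subset\mathbb{C}$ is a smooth bounded one-point quadrature domain with respect to the weighted area measure $|z|^{2p}dA$ whose quadrature node is the origin, then $\Omega$ is a disc centered at the origin.
   Context: Natural numbers are $1,2,3,\dots$; $dA$ is Lebesgue area measure; a smooth bounded domain is a bounded connected open set with $\mathcal{C}^\infty$ smooth boundary. $\mathcal{A}^\infty(\Omega)$ is the space of analytic functions on $\Omega$ that are $\mathcal{C}^\infty$ smooth up to the boundary. $\Omega$ is a one-point quadrature domain with respect to $|z|^{2p}dA$ with quadrature node $z_0\in\Omega$ if there is a constant $c\in\mathbb{C}$ such that $\int_\Omega f(z)|z|^{2p}dA=c\,f(z_0)$ for all $f\in\mathcal{A}^\infty(\Omega)$. *)

theory Defs
  imports "HOL-Complex_Analysis.Complex_Analysis"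
begin

definition dir_deriv :: "complex \<Rightarrow> (complex \<Rightarrow> 'b::real_normed_vector) \<Rightarrow> complex \<Rightarrow> 'b"
  where "dir_deriv v f z = frechet_derivative f (at z) v"

text \<open>For complex numbers, \<^term>\<open>Basis :: complex set\<close> consists of \<^term>\<open>1 :: complex\<close> and
  \<^term>\<open>\<i>\<close>, so the iterated derivatives below are exactly the mixed real partial derivatives
  with respect to \<open>x\<close> and \<open>y\<close>. Differentiability of all of them makes them all continuous.\<close>

definition C_infinity_on :: "complex set \<Rightarrow> (complex \<Rightarrow> 'b::real_normed_vector) \<Rightarrow> bool"
  where "C_infinity_on U f \<longleftrightarrow>
    (\<forall>vs. set vs \<subseteq> Basis \<longrightarrow> (\<forall>z\<in>U. (fold dir_deriv vs f) differentiable (at z)))"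

text \<open>Smoothness up to the boundary: \<open>f\<close> is smooth on the open set and every partial derivative
  (including \<open>f\<close> itself) extends continuously to the closure.
  The values of \<open>f\<close> outside \<open>\<Omega>\<close> are irrelevant.\<close>

definition C_infinity_up_to_boundary ::
    "complex set \<Rightarrow> (complex \<Rightarrow> 'b::real_normed_vector) \<Rightarrow> bool"
  where "C_infinity_up_to_boundary \<Omega> f \<longleftrightarrow> C_infinity_on \<Omega> f \<and>
    (\<forall>vs. set vs \<subseteq> Basis \<longrightarrow>
      (\<exists>g. continuous_on (closure \<Omega>) g \<and> (\<forall>z\<in>\<Omega>. g z = fold dir_deriv vs f z)))"

definition A_infinity :: "complex set \<Rightarrow> (complex \<Rightarrow> complex) set"
  where "A_infinity \<Omega> = {f. f holomorphic_on \<Omega> \<and> C_infinity_up_to_boundary \<Omega> f}"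

text \<open>Near each boundary point, the set is the negative side of a smooth real
  defining function whose differential does not vanish at that point.\<close>

definition C_infinity_boundary :: "complex set \<Rightarrow> bool"
  where "C_infinity_boundary \<Omega> \<longleftrightarrow>
    (\<forall>a\<in>frontier \<Omega>. \<exists>U (\<rho> :: complex \<Rightarrow> real).
        open U \<and> a \<in> U \<and> C_infinity_on U \<rho> \<and>
        \<rho> a = 0 \<and> (\<exists>v. dir_deriv v \<rho> a \<noteq> 0) \<and>
        \<Omega> \<inter> U = {z\<in>U. \<rho> z < 0})"

definition smooth_bounded_domain :: "complex set \<Rightarrow> bool"
  where "smooth_bounded_domain \<Omega> \<longleftrightarrow>
    open \<Omega> \<and> connected \<Omega> \<and> \<Omega> \<noteq> {} \<and> bounded \<Omega> \<and> C_infinity_boundary \<Omega>"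

definition one_point_quadrature_domain :: "nat \<Rightarrow> complex set \<Rightarrow> complex \<Rightarrow> bool"
  where "one_point_quadrature_domain p \<Omega> z0 \<longleftrightarrow> z0 \<in> \<Omega> \<and>
    (\<exists>c. \<forall>f\<in>A_infinity \<Omega>.
      (LINT z:\<Omega>|lborel. f z * complex_of_real (cmod z ^ (2 * p))) = c * f z0)"

end

theory Submission
  imports Defs
begin

text \<open>Kuran's argument. Let \<open>a\<close> be a boundary point nearest to \<open>0\<close> and \<open>r = \<bar>a\<bar>\<close>. For \<open>w\<close> outside the
  closure of \<open>\<Omega>\<close> the function \<open>z / (z - w)\<close> is admissible and vanishes at \<open>0\<close>; since the weight is
  radial, its weighted integral over \<open>ball 0 r\<close> vanishes as well, hence so does the one over
  \<open>\<Omega> - ball 0 r\<close>. Letting \<open>w\<close> tend to \<open>a\<close> along an outward direction gives the same for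
  \<open>z / (z - a)\<close>, whose real part is at least \<open>1 / 2\<close> outside \<open>ball 0 r\<close>. So \<open>\<Omega> - ball 0 r\<close> is null.\<close>

section \<open>Rotation invariance of planar Lebesgue measure\<close>

text \<open>Boxes determine \<open>lborel\<close>, and the preimage of a box is its image under the
  orthogonal map \<open>inv T\<close>, which preserves \<open>lebesgue\<close>; the preimage is
  Borel, so both measures agree on it.\<close>

lemma distr_lborel_orthogonal_transformation:
  fixes T :: "real^'n::{finite,wellorder} \<Rightarrow> real^'n::_"
  assumes T: "orthogonal_transformation T"
  shows "distr lborel borel T = lborel"
proof (rule lborel_eqI[symmetric])
  fix l u :: "real^'n::_" assume le: "\<And>b. b \<in> Basis \<Longrightarrow> l \<bullet> b \<le> u \<bullet> b"
  have lin: "linear T" using T by (rule orthogonal_transformation_linear)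
  then have meas: "T \<in> borel_measurable borel"
    by (intro borel_measurable_continuous_onI) (simp add: linear_continuous_on linear_conv_bounded_linear)
  have bij: "bij T" using T by (rule orthogonal_transformation_bij)
  have inv: "orthogonal_transformation (inv T)" using T by (rule orthogonal_transformation_inv)
  have eq: "T -` box l u = inv T ` box l u"
    using bij by (simp add: bij_vimage_eq_inv_image)
  have lm: "T -` box l u \<in> lmeasurable"
    unfolding eq by (rule measurable_orthogonal_image[OF inv]) simp
  have sets: "T -` box l u \<in> sets borel"
    using meas by (metis borel_open measurable_sets_borel open_box)
  have "emeasure (distr lborel borel T) (box l u) = emeasure lborel (T -` box l u)"
    using meas by (subst emeasure_distr) auto
  also have "\<dots> = emeasure lebesgue (T -` box l u)"
    using sets by (simp add: emeasure_completion)
  also have "\<dots> = ennreal (measure lebesgue (box l u))"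
    using lm measure_orthogonal_image[OF inv lmeasurable_box[of l u]] eq
    by (metis emeasure_eq_measure2)
  also have "\<dots> = (\<Prod>b\<in>Basis. (u - l) \<bullet> b)"
    using le by (simp add: measure_completion measure_lborel_box_eq inner_diff_left)
  finally show "emeasure (distr lborel borel T) (box l u) = (\<Prod>b\<in>Basis. (u - l) \<bullet> b)" .
qed simp

text \<open>Carries the result for \<open>real^2\<close> over to \<open>complex\<close>: the
  identification takes boxes to boxes with the same side lengths.\<close>

lemma distr_lborel_Complex:
  "distr lborel borel (\<lambda>x :: real^2. Complex (x $ 1) (x $ 2)) = lborel"
proof (rule lborel_eqI[symmetric])
  let ?\<phi> = "\<lambda>x :: real^2. Complex (x $ 1) (x $ 2)"
  fix l u :: complex assume le: "\<And>b. b \<in> Basis \<Longrightarrow> l \<bullet> b \<le> u \<bullet> b"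
  let ?l = "vector [Re l, Im l] :: real^2" and ?u = "vector [Re u, Im u] :: real^2"
  have vim: "?\<phi> -` box l u = box ?l ?u"
    by (auto simp: box_def Basis_complex_def Basis_vec_def inner_axis forall_2)
  have meas: "?\<phi> \<in> borel_measurable borel"
    by (intro borel_measurable_continuous_onI) (auto intro!: continuous_intros simp: Complex_eq)
  have le': "\<forall>b\<in>Basis. ?l \<bullet> b \<le> ?u \<bullet> b"
    using le[of 1] le[of \<i>] by (auto simp: Basis_complex_def Basis_vec_def inner_axis forall_2)
  have "(\<Prod>b\<in>Basis. (?u - ?l) \<bullet> b) = (Re u - Re l) * (Im u - Im l)"
  proof -
    have Basis_2: "(Basis :: (real^2) set) = {axis 1 1, axis 2 1}"
      by (auto simp: Basis_vec_def UNIV_2)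
    show ?thesis unfolding Basis_2 by (simp add: inner_axis axis_eq_axis)
  qed
  also have "\<dots> = (\<Prod>b\<in>Basis. (u - l) \<bullet> b)"
    by (simp add: Basis_complex_def)
  finally have "(\<Prod>b\<in>Basis. (?u - ?l) \<bullet> b) = (\<Prod>b\<in>Basis. (u - l) \<bullet> b)" .
  moreover have "emeasure (distr lborel borel ?\<phi>) (box l u) = emeasure lborel (box ?l ?u)"
    using meas by (subst emeasure_distr) (auto simp: vim)
  ultimately show "emeasure (distr lborel borel ?\<phi>) (box l u) = (\<Prod>b\<in>Basis. (u - l) \<bullet> b)"
    using le' by (simp add: emeasure_lborel_box_eq)
qed simp

text \<open>The identification \<open>?\<phi>\<close> conjugates multiplication by \<open>c\<close>
  to the real matrix \<open>?T\<close>, which is orthogonal because \<open>c\<close> has modulus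
  one.\<close>

lemma distr_lborel_rotation:
  fixes c :: complex
  assumes c: "cmod c = 1"
  shows "distr lborel borel ((*) c) = lborel"
proof -
  let ?\<phi> = "\<lambda>x :: real^2. Complex (x $ 1) (x $ 2)"
  let ?T = "\<lambda>x :: real^2. vector [Re c * x$1 - Im c * x$2, Re c * x$2 + Im c * x$1] :: real^2"
  have lin: "linear ?T"
    by (rule linearI) (auto simp: vec_eq_iff forall_2 algebra_simps)
  have c2: "(Re c)\<^sup>2 + (Im c)\<^sup>2 = 1" using c by (simp add: cmod_def)
  have "norm (?T x) = norm x" for x
  proof -
    have "(Re c * x$1 - Im c * x$2)\<^sup>2 + (Re c * x$2 + Im c * x$1)\<^sup>2
        = ((Re c)\<^sup>2 + (Im c)\<^sup>2) * ((x$1)\<^sup>2 + (x$2)\<^sup>2)"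
      by algebra
    with c2 show ?thesis by (simp add: norm_vec_def L2_set_def sum_2)
  qed
  with lin have T: "orthogonal_transformation ?T"
    by (simp add: orthogonal_transformation)
  have m\<phi>: "?\<phi> \<in> borel_measurable borel"
    by (intro borel_measurable_continuous_onI) (auto intro!: continuous_intros simp: Complex_eq)
  have mT: "?T \<in> borel_measurable borel"
    using lin by (intro borel_measurable_continuous_onI) (simp add: linear_continuous_on linear_conv_bounded_linear)
  have comm: "(*) c \<circ> ?\<phi> = ?\<phi> \<circ> ?T"
    by (auto simp: fun_eq_iff complex_eq_iff)
  have "distr lborel borel ((*) c) = distr (distr lborel borel ?\<phi>) borel ((*) c)"
    by (simp add: distr_lborel_Complex)
  also have "\<dots> = distr lborel borel (?\<phi> \<circ> ?T)"
    using m\<phi> by (subst distr_distr) (auto simp: comm)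
  also have "\<dots> = distr (distr lborel borel ?T) borel ?\<phi>"
    using m\<phi> mT by (subst distr_distr) auto
  also have "\<dots> = lborel"
    by (simp add: distr_lborel_orthogonal_transformation[OF T] distr_lborel_Complex)
  finally show ?thesis .
qed

section \<open>Weighted integrals over a centered disc\<close>

lemma set_integral_ball_rotation:
  fixes g :: "complex \<Rightarrow> complex"
  assumes g: "g \<in> borel_measurable borel" and c: "cmod c = 1"
  shows "(LINT z:ball 0 r|lborel. g (c * z)) = (LINT z:ball 0 r|lborel. g z)"
proof -
  have "(LINT z:ball 0 r|lborel. g z) = (LINT z:ball 0 r|distr lborel borel ((*) c). g z)"
    using c by (simp add: distr_lborel_rotation)
  also have "\<dots> = (LINT z|lborel. indicator (ball 0 r) (c * z) *\<^sub>R g (c * z))"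
    unfolding set_lebesgue_integral_def using g by (subst integral_distr) (auto intro!: borel_measurable_scaleR borel_measurable_indicator)
  also have "\<dots> = (LINT z:ball 0 r|lborel. g (c * z))"
    unfolding set_lebesgue_integral_def
    using c by (intro Bochner_Integration.integral_cong) (auto simp: indicator_def norm_mult)
  finally show ?thesis by simp
qed

text \<open>Rotation by \<open>pi / k\<close> changes the sign of \<open>z ^ k\<close> and preserves
  the radial weight, so the integral equals its own negative.\<close>

lemma set_integral_ball_power_eq_0:
  assumes k: "k \<ge> 1"
  shows "(LINT z:ball 0 r|lborel. z ^ k * complex_of_real (cmod z ^ m)) = 0"
proof -
  let ?g = "\<lambda>z. z ^ k * complex_of_real (cmod z ^ m)"
  let ?c = "cis (pi / k)"
  have "?c ^ k = - 1"
    using k by (simp add: Complex.DeMoivre)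
  then have neg: "?g (?c * z) = - ?g z" for z
    by (simp add: power_mult_distrib norm_mult)
  have "(LINT z:ball 0 r|lborel. ?g (?c * z)) = (LINT z:ball 0 r|lborel. ?g z)"
    by (rule set_integral_ball_rotation) auto
  then show ?thesis
    unfolding neg set_lebesgue_integral_def by simp
qed

lemma set_integrable_lborel_continuous:
  fixes f :: "'a::euclidean_space \<Rightarrow> 'b::{banach, second_countable_topology}"
  assumes "bounded S" "S \<in> sets borel" "continuous_on (closure S) f"
  shows "set_integrable lborel S f"
proof (rule set_integrable_subset)
  show "set_integrable lborel (closure S) f"
    unfolding set_integrable_def using assms by (intro borel_integrable_compact) auto
qed (use assms closure_subset in auto)

text \<open>Multiplying the integrand by \<open>z / w\<close> changes it by a multiple of a weighted positive power
  of \<open>z\<close>, hence does not change the integral; iterating drives the integral to zero because \<open>\<bar>z / w\<bar> < 1\<close> uniformly.\<close>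

lemma set_integral_ball_kernel_eq_0:
  assumes r: "r > 0" and w: "cmod w > r"
  shows "(LINT z:ball 0 r|lborel. z / (z - w) * complex_of_real (cmod z ^ m)) = 0"
proof -
  define g where "g = (\<lambda>z. z / (z - w) * complex_of_real (cmod z ^ m))"
  define I where "I = (\<lambda>n. LINT z:ball 0 r|lborel. (z / w) ^ n * g z)"
  have w0: "w \<noteq> 0" using r w by auto
  have cont: "continuous_on (cball 0 r) (\<lambda>z. (z / w) ^ n * g z)" for n
    unfolding g_def using w w0 by (intro continuous_intros) auto
  have int: "set_integrable lborel (ball 0 r) (\<lambda>z. (z / w) ^ n * g z)" for n
    using cont[of n] r by (intro set_integrable_lborel_continuous) auto
  have "I (Suc n) = I n" for n
  proof -
    have "I (Suc n) - I n = (LINT z:ball 0 r|lborel. (z / w) ^ Suc n * g z - (z / w) ^ n * g z)"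
      unfolding I_def by (rule set_integral_diff(2)[symmetric]) (rule int)+
    also have "\<dots> = (LINT z:ball 0 r|lborel. (1 / w ^ Suc n) * (z ^ Suc n * complex_of_real (cmod z ^ m)))"
    proof (rule set_lebesgue_integral_cong)
      show "\<forall>z. z \<in> ball 0 r \<longrightarrow> (z / w) ^ Suc n * g z - (z / w) ^ n * g z
          = (1 / w ^ Suc n) * (z ^ Suc n * complex_of_real (cmod z ^ m))"
      proof (intro allI impI)
        fix z :: complex assume "z \<in> ball 0 r"
        then have "z - w \<noteq> 0" using w by auto
        \<comment> \<open>Since \<open>z / w - 1 = (z - w) / w\<close>, this factor cancels the
          denominator of the kernel and leaves a pure power of \<open>z\<close> times the
          weight.\<close>
        then have "(z / w - 1) * (z / (z - w)) = z / w" using w0 by (simp add: field_simps)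
        moreover have "(z / w) ^ Suc n * g z - (z / w) ^ n * g z
            = (z / w) ^ n * ((z / w - 1) * (z / (z - w))) * complex_of_real (cmod z ^ m)"
        proof -
          have "q * X * (D * B) - X * (D * B) = X * ((q - 1) * D) * B" for q X D B :: complex
            by (simp add: algebra_simps)
          then show ?thesis unfolding g_def power_Suc .
        qed
        ultimately show "(z / w) ^ Suc n * g z - (z / w) ^ n * g z
            = (1 / w ^ Suc n) * (z ^ Suc n * complex_of_real (cmod z ^ m))"
          by (simp add: power_divide mult_ac)
      qed
    qed simp
    also have "\<dots> = 0"
      using set_integral_ball_power_eq_0[of "Suc n" r m] by (simp del: power_Suc)
    finally show ?thesis by simp
  qed
  then have const: "I n = I 0" for n by (induction n) auto
  have "bounded ((\<lambda>z. (z / w) ^ 0 * g z) ` cball 0 r)"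
    by (rule compact_imp_bounded[OF compact_continuous_image[OF cont]]) simp
  then obtain C where "\<forall>z\<in>cball 0 r. cmod (g z) \<le> C"
    unfolding bounded_iff by auto
  then have C: "cmod (g z) \<le> C" if "z \<in> cball 0 r" for z
    using that by blast
  have "C \<ge> 0" using C[of 0] r by (smt (verit) norm_ge_zero centre_in_cball)
  let ?A = "LINT z:ball (0::complex) r|lborel. (1::real)"
  have bound: "cmod (I 0) \<le> (r / cmod w) ^ n * (C * ?A)" for n
  proof -
    have "cmod (I n) \<le> (LINT z:ball 0 r|lborel. cmod ((z / w) ^ n * g z))"
      unfolding I_def by (rule set_integral_norm_bound[OF int])
    also have "\<dots> \<le> (LINT z:ball (0::complex) r|lborel. (r / cmod w) ^ n * C)"
    proof (rule set_integral_mono)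
      show "set_integrable lborel (ball 0 r) (\<lambda>z. cmod ((z / w) ^ n * g z))"
        using int by (rule set_integrable_norm)
      show "set_integrable lborel (ball 0 r) (\<lambda>z::complex. (r / cmod w) ^ n * C)"
        by (intro set_integrable_lborel_continuous continuous_intros) auto
      fix z :: complex assume z: "z \<in> ball 0 r"
      then have "cmod z / cmod w \<le> r / cmod w" by (intro divide_right_mono) auto
      then have "(cmod z / cmod w) ^ n \<le> (r / cmod w) ^ n" by (intro power_mono) auto
      then show "cmod ((z / w) ^ n * g z) \<le> (r / cmod w) ^ n * C"
        using C[of z] z \<open>C \<ge> 0\<close> r
        by (simp add: norm_mult norm_power norm_divide mult_mono)
    qed
    also have "\<dots> = (r / cmod w) ^ n * (C * ?A)"
      using set_integral_mult_right[of lborel "ball (0::complex) r" "(r / cmod w) ^ n * C" "\<lambda>_. 1"]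
      by (simp add: mult_ac del: set_integral_mult_right)
    finally show ?thesis using const[of n] by simp
  qed
  have "(\<lambda>n. (r / cmod w) ^ n * (C * ?A)) \<longlonglongrightarrow> 0 * (C * ?A)"
    using r w by (intro tendsto_intros LIMSEQ_power_zero) (auto simp: divide_simps)
  then have "cmod (I 0) \<le> 0"
    using bound by (intro LIMSEQ_le_const) auto
  then show ?thesis unfolding I_def g_def by simp
qed

section \<open>Test functions holomorphic across the boundary\<close>

text \<open>For holomorphic \<open>f\<close> the directional derivative along \<open>v\<close> is
  \<open>deriv f z * v\<close>, again holomorphic, so induction over the directions applies with
  \<open>f\<close> general.\<close>

lemma fold_dir_deriv_holomorphic_on:
  assumes "open V" "f holomorphic_on V"
  shows "fold dir_deriv vs f holomorphic_on V"
  using assms(2)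
proof (induction vs arbitrary: f)
  case (Cons v vs)
  have "dir_deriv v f z = deriv f z * v" if "z \<in> V" for z
  proof -
    have "(f has_derivative (*) (deriv f z)) (at z)"
      using holomorphic_derivI[OF Cons.prems \<open>open V\<close> that] by (simp add: has_field_derivative_def)
    then show ?thesis
      unfolding dir_deriv_def by (metis frechet_derivative_at)
  qed
  moreover have "(\<lambda>z. deriv f z * v) holomorphic_on V"
    using Cons.prems \<open>open V\<close> by (intro holomorphic_intros)
  ultimately have "dir_deriv v f holomorphic_on V"
    using holomorphic_transform by metis
  then show ?case using Cons.IH by simp
qed simp

text \<open>Every iterated partial derivative is holomorphic on \<open>V\<close>, hence continuous
  on the closure, and serves as its own continuous extension.\<close>

lemma A_infinity_holomorphic_on:
  assumes V: "open V" "closure \<Omega> \<subseteq> V" and f: "f holomorphic_on V"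
  shows "f \<in> A_infinity \<Omega>"
proof -
  have sub: "\<Omega> \<subseteq> V" using V(2) closure_subset by blast
  have hol: "fold dir_deriv vs f holomorphic_on V" for vs
    by (rule fold_dir_deriv_holomorphic_on[OF V(1) f])
  have "f holomorphic_on \<Omega>" using f sub by (rule holomorphic_on_subset)
  moreover have "fold dir_deriv vs f differentiable at z" if "z \<in> \<Omega>" for vs z
    using hol[of vs] V(1) sub that
    by (meson field_differentiable_imp_differentiable holomorphic_on_imp_differentiable_at subsetD)
  moreover have "continuous_on (closure \<Omega>) (fold dir_deriv vs f)" for vs
    using hol[of vs] V(2) holomorphic_on_imp_continuous_on continuous_on_subset by blast
  ultimately show ?thesis
    unfolding A_infinity_def C_infinity_up_to_boundary_def C_infinity_on_def by blast
qed

section \<open>Integrability of the simple pole in the plane\<close>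

lemma ex_power2_interval:
  fixes x :: real
  assumes "x \<ge> 1"
  obtains n where "2 ^ n \<le> x" "x < 2 ^ Suc n"
proof -
  define m where "m = (LEAST m. x < 2 ^ m)"
  obtain m' where "x < 2 ^ m'" using real_arch_pow[of 2 x] by auto
  then have m: "x < 2 ^ m" unfolding m_def by (rule LeastI)
  with assms obtain n where n: "m = Suc n" by (cases m) auto
  have "\<not> x < 2 ^ n" using not_less_Least[of n "\<lambda>m. x < 2 ^ m"] n m_def by simp
  then show thesis using that[of n] m n by (simp add: not_less)
qed

text \<open>The function is dominated by a sum of constants \<open>2 ^ Suc n / R\<close> on discs of
  radius \<open>R / 2 ^ n\<close>. The areas shrink like \<open>1 / 4 ^ n\<close>, so the integrals
  form a geometric series of ratio \<open>1 / 2\<close>.\<close>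

lemma set_integrable_inverse_norm_complex:
  fixes S :: "complex set"
  assumes "bounded S" "S \<in> sets borel"
  shows "set_integrable lborel S (\<lambda>z. 1 / cmod (z - a))"
proof -
  obtain R where R: "R > 0" "S \<subseteq> ball a R"
    using bounded_subset_ballD[OF assms(1), of a] by auto
  let ?f = "\<lambda>z. indicator (ball a R) z *\<^sub>R (1 / cmod (z - a))"
  let ?B = "\<lambda>n::nat. cball a (R / 2 ^ n)"
  let ?h = "\<lambda>n z. ennreal (2 ^ Suc n / R) * indicator (?B n) z"
  \<comment> \<open>One term of the series suffices. Off the disc the indicator vanishes, and at
    \<open>z = a\<close> the convention \<open>1 / 0 = 0\<close> makes the left side zero.\<close>
  have le: "ennreal (norm (?f z)) \<le> (\<Sum>n. ?h n z)" for z
  proof (cases "z \<in> ball a R \<and> z \<noteq> a")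
    case True
    define d where "d = cmod (z - a)"
    have d: "0 < d" "d < R" using True by (auto simp: d_def dist_norm norm_minus_commute)
    \<comment> \<open>The upper bound gives \<open>1 / d < 2 ^ Suc n / R\<close>; the lower bound
      puts \<open>z\<close> into \<open>?B n\<close>.\<close>
    then obtain n where n: "2 ^ n \<le> R / d" "R / d < 2 ^ Suc n"
      using ex_power2_interval[of "R / d"] by auto
    have d': "cmod (a - z) = d" by (simp add: d_def norm_minus_commute)
    have "ennreal (norm (?f z)) \<le> ennreal (2 ^ Suc n / R)"
      using True n d R unfolding d_def[symmetric] by (intro ennreal_leI) (auto simp: field_simps d_def[symmetric])
    also have "\<dots> = ?h n z"
      using n d by (auto simp: indicator_def dist_norm d' field_simps)
    also have "\<dots> \<le> (\<Sum>n. ?h n z)"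
    proof -
      have "(\<Sum>n\<in>{n}. ?h n z) \<le> (\<Sum>n. ?h n z)" by (rule sum_le_suminf) auto
      then show ?thesis by (simp only: sum.insert finite.emptyI sum.empty empty_iff not_False_eq_True add_0_right)
    qed
    finally show ?thesis .
  qed auto
  have meas: "?f \<in> borel_measurable lborel"
    by (intro borel_measurable_scaleR borel_measurable_indicator) simp_all
  have "(\<integral>\<^sup>+z. ennreal (norm (?f z)) \<partial>lborel) \<le> (\<integral>\<^sup>+z. (\<Sum>n. ?h n z) \<partial>lborel)"
    using le by (rule nn_integral_mono)
  also have "\<dots> = (\<Sum>n. \<integral>\<^sup>+z. ?h n z \<partial>lborel)"
  proof (rule nn_integral_suminf)
    fix n
    have [measurable]: "?B n \<in> sets borel" by simp
    show "?h n \<in> borel_measurable lborel" by measurable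
  qed
  also have "\<dots> = (\<Sum>n. ennreal (2 * unit_ball_vol 2 * R * (1 / 2) ^ n))"
  proof (rule suminf_cong)
    fix n
    have "(\<integral>\<^sup>+z. ?h n z \<partial>lborel) = ennreal (2 ^ Suc n / R) * ennreal (unit_ball_vol 2 * (R / 2 ^ n)\<^sup>2)"
      using R by (simp add: nn_integral_cmult_indicator emeasure_cball)
    also have "\<dots> = ennreal (2 ^ Suc n / R * (unit_ball_vol 2 * (R / 2 ^ n)\<^sup>2))"
      using R by (intro ennreal_mult'[symmetric]) auto
    also have "2 ^ Suc n / R * (unit_ball_vol 2 * (R / 2 ^ n)\<^sup>2) = 2 * unit_ball_vol 2 * R * (1 / 2) ^ n"
      using R by (simp add: field_simps power2_eq_square)
    finally show "(\<integral>\<^sup>+z. ?h n z \<partial>lborel) = ennreal (2 * unit_ball_vol 2 * R * (1 / 2) ^ n)" .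
  qed
  also have "\<dots> < \<infinity>"
  proof (subst suminf_ennreal2)
    show "summable (\<lambda>n. 2 * unit_ball_vol 2 * R * (1 / 2) ^ n)"
      by (rule summable_mult[OF summable_geometric]) simp
  qed (use R in auto)
  finally have "set_integrable lborel (ball a R) (\<lambda>z. 1 / cmod (z - a))"
    unfolding set_integrable_def by (rule integrableI_bounded[OF meas])
  then show ?thesis
    by (rule set_integrable_subset) (use R(2) assms(2) in auto)
qed

section \<open>Approaching a smooth boundary point from outside\<close>

text \<open>Near \<open>a\<close> the set \<open>\<Omega>\<close> avoids a cone around the outward direction \<open>v\<close>, so that \<open>\<bar>z - (a + t v)\<bar>\<close> is
  comparable to \<open>\<bar>z - a\<bar>\<close> for \<open>z \<in> \<Omega>\<close>, uniformly in \<open>t\<close>.\<close>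

lemma exterior_approach:
  fixes \<rho> :: "'a::real_normed_vector \<Rightarrow> real"
  assumes U: "open U" "a \<in> U" and cont: "continuous_on U \<rho>"
    and der: "(\<rho> has_derivative L) (at a)" and a: "\<rho> a = 0" and u: "L u \<noteq> 0"
    and \<Omega>: "\<Omega> \<inter> U = {z\<in>U. \<rho> z < 0}"
  obtains v K t0 where "K > 0" "t0 > 0"
    "\<And>t. 0 < t \<Longrightarrow> t < t0 \<Longrightarrow> a + t *\<^sub>R v \<notin> closure \<Omega>"
    "\<And>t z. 0 < t \<Longrightarrow> t < t0 \<Longrightarrow> z \<in> \<Omega> \<Longrightarrow> norm (z - a) \<le> K * norm (z - (a + t *\<^sub>R v))"
proof -
  have L: "bounded_linear L" using der by (rule has_derivative_bounded_linear)
  \<comment> \<open>Normalized so that \<open>L v = 1\<close>: to first order \<open>\<rho>\<close>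
    equals \<open>t\<close> at \<open>a + t *\<^sub>R v\<close>.\<close>
  define v where "v = (1 / L u) *\<^sub>R u"
  have v: "L v = 1"
    using u L by (simp add: v_def linear_cmul[OF bounded_linear.linear])
  obtain N where N: "N > 0" "\<And>x. norm (L x) \<le> norm x * N"
    using bounded_linear.pos_bounded[OF L] by blast
  \<comment> \<open>At \<open>a + t *\<^sub>R v\<close> the linearization error is then at most
    \<open>t / 2\<close>, which keeps \<open>\<rho>\<close> positive there. The summand 1 makes the
    denominator visibly positive.\<close>
  define e where "e = 1 / (2 * (norm v + 1))"
  have e: "e > 0" "e * norm v \<le> 1 / 2"
    by (auto simp: e_def divide_simps add_nonneg_pos intro: add_nonneg_pos)
  obtain d1 where d1: "d1 > 0" "\<And>y. norm (y - a) < d1 \<Longrightarrow> norm (\<rho> y - \<rho> a - L (y - a)) \<le> e * norm (y - a)"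
    using der e(1) unfolding has_derivative_at_alt by blast
  obtain d2 where d2: "d2 > 0" "ball a d2 \<subseteq> U" using U openE by blast
  define d where "d = min d1 d2"
  have d: "d > 0" using d1 d2 by (simp add: d_def)
  have near: "y \<in> U" "\<bar>\<rho> y - L (y - a)\<bar> \<le> e * norm (y - a)" if "norm (y - a) < d" for y
    using d1(2)[of y] d2(2) a that by (auto simp: d_def dist_norm norm_minus_commute subset_iff)
  \<comment> \<open>Ensures \<open>t * norm v < d / 2\<close>: the approach points stay where the
    linearization holds, and a point at distance at least \<open>d\<close> from \<open>a\<close>
    loses at most half of that distance.\<close>
  define t0 where "t0 = d / (2 * (norm v + 1))"
  have vpos: "norm v + 1 > 0" by (simp add: add_nonneg_pos)
  have t0: "t0 > 0" using d vpos by (simp add: t0_def)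
  have tv: "t * norm v < d / 2" if "0 < t" "t < t0" for t
  proof -
    have "t * norm v \<le> t * (norm v + 1)" using that by (intro mult_left_mono) auto
    also have "\<dots> < t0 * (norm v + 1)" using that vpos by (intro mult_strict_right_mono) auto
    also have "\<dots> = d / 2" using vpos by (simp add: t0_def del: distrib_left_numeral)
    finally show ?thesis .
  qed
  \<comment> \<open>The near case combines the triangle inequality with
    \<open>t \<le> N * norm (z - ?w) + e * norm (z - a)\<close>. The \<open>e\<close> term
    contributes at most half of \<open>norm (z - a)\<close>; absorbing it on the left produces the
    factor 2.\<close>
  define K where "K = 2 * (1 + N * norm v)"
  have K: "K \<ge> 2" using N by (simp add: K_def)
  show thesis
  proof (rule that[of K t0 v])
    show "K > 0" "t0 > 0" using K t0 by auto
  next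
    fix t assume t: "0 < t" "t < t0"
    let ?w = "a + t *\<^sub>R v"
    have nw: "norm (?w - a) = t * norm v" using t by simp
    with tv[OF t] d have "norm (?w - a) < d" by linarith
    note w = near[OF this]
    have "L (?w - a) = t" using v L by (simp add: linear_cmul[OF bounded_linear.linear])
    with w(2) have "t - \<rho> ?w \<le> e * norm (?w - a)" by linarith
    also have "\<dots> = t * (e * norm v)" unfolding nw by (simp only: mult_ac)
    also have "\<dots> \<le> t * (1 / 2)" using t e(2) by (intro mult_left_mono) auto
    finally have "\<rho> ?w > 0" using t by simp
    \<comment> \<open>Positivity of \<open>\<rho>\<close> is an open condition and excludes
      \<open>\<Omega>\<close>, so it excludes the closure as well.\<close>
    then have "?w \<in> U \<inter> \<rho> -` {0<..}" using w(1) by simp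
    moreover have "open (U \<inter> \<rho> -` {0<..})"
      using cont U(1) by (rule continuous_open_preimage) simp
    moreover have "(U \<inter> \<rho> -` {0<..}) \<inter> \<Omega> = {}" using \<Omega> by force
    ultimately show "?w \<notin> closure \<Omega>"
      using open_Int_closure_eq_empty by blast
  next
    fix t z assume t: "0 < t" "t < t0" and z: "z \<in> \<Omega>"
    let ?w = "a + t *\<^sub>R v"
    have tri: "norm (z - a) \<le> norm (z - ?w) + t * norm v"
      using norm_triangle_ineq[of "z - ?w" "t *\<^sub>R v"] t by simp
    show "norm (z - a) \<le> K * norm (z - ?w)"
    proof (cases "norm (z - a) < d")
      case True
      note nz = near[OF True]
      \<comment> \<open>The functional \<open>L\<close> separates the two points: it is
        \<open>t\<close> at \<open>?w - a\<close> but at most \<open>e * norm (z - a)\<close> at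
        \<open>z - a\<close>, which bounds \<open>t\<close> by their distance plus a small
        error.\<close>
      have "\<rho> z < 0" using z nz(1) \<Omega> by blast
      then have 1: "L (z - a) \<le> e * norm (z - a)" using nz(2) by linarith
      have "L (?w - z) = t - L (z - a)"
      proof -
        have "?w - z = t *\<^sub>R v - (z - a)" by simp
        then have "L (?w - z) = L (t *\<^sub>R v) - L (z - a)"
          using linear_diff[OF bounded_linear.linear[OF L]] by metis
        then show ?thesis using v L by (simp add: linear_cmul[OF bounded_linear.linear])
      qed
      moreover have "L (?w - z) \<le> N * norm (z - ?w)"
        using N(2)[of "?w - z"] by (simp add: norm_minus_commute mult.commute)
      ultimately have "t \<le> N * norm (z - ?w) + e * norm (z - a)" using 1 by linarith
      then have "t * norm v \<le> (N * norm (z - ?w) + e * norm (z - a)) * norm v"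
        by (rule mult_right_mono) simp
      moreover have "e * norm v * norm (z - a) \<le> 1 / 2 * norm (z - a)"
        using e(2) by (rule mult_right_mono) simp
      ultimately show ?thesis using tri by (simp add: K_def algebra_simps)
    next
      case False
      then have "norm (z - a) \<le> 2 * norm (z - ?w)" using tri tv[OF t] by linarith
      also have "\<dots> \<le> K * norm (z - ?w)" using K by (intro mult_right_mono) auto
      finally show ?thesis .
    qed
  qed
qed

section \<open>Positivity of the kernel and of open sets\<close>

text \<open>After multiplying by the squared modulus of \<open>z - w\<close>, the claim holds
  because \<open>2 * Re (z * cnj (z - w))\<close> exceeds that square by
  \<open>(cmod z)\<^sup>2 - (cmod w)\<^sup>2\<close>.\<close>

lemma Re_kernel_ge_half:
  assumes "cmod w \<le> cmod z" "z \<noteq> w"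
  shows "Re (z / (z - w)) \<ge> 1 / 2"
proof -
  have pos: "(cmod (z - w))\<^sup>2 > 0" using assms by simp
  have "(cmod w)\<^sup>2 \<le> (cmod z)\<^sup>2" using assms by simp
  then have "(cmod (z - w))\<^sup>2 \<le> 2 * Re (z * cnj (z - w))"
    unfolding cmod_power2 by (simp add: algebra_simps power2_eq_square)
  then show ?thesis
    using pos by (simp add: complex_div_cnj[of z] Re_divide_of_real del: Re_divide flip: of_real_power)
qed

text \<open>Used to turn a null remainder into an empty one. Boundedness makes the measure finite,
  so that the real-valued \<open>measure\<close> is monotone.\<close>

lemma measure_lborel_pos:
  fixes S :: "'a::euclidean_space set"
  assumes S: "bounded S" "S \<in> sets borel" and T: "open T" "T \<noteq> {}" "T \<subseteq> S"
  shows "measure lborel S > 0"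
proof -
  obtain x s where s: "s > 0" "ball x s \<subseteq> T"
    using T(1,2) by (meson ex_in_conv openE)
  have "0 < measure lborel (ball x s)"
    using s by (simp add: content_ball)
  also have "\<dots> \<le> measure lborel S"
    using s T S emeasure_bounded_finite[of S]
    by (intro measure_mono_fmeasurable) (auto simp: fmeasurable_def)
  finally show ?thesis .
qed

section \<open>Kuran's argument with the radial weight\<close>

theorem theorem5:
  fixes p :: nat and \<Omega> :: "complex set"
  assumes "p \<ge> 1"
    and "smooth_bounded_domain \<Omega>"
    and "one_point_quadrature_domain p \<Omega> 0"
  shows "\<exists>r>0. \<Omega> = ball 0 r"
proof -
  from assms(2) have op: "open \<Omega>" and bd: "bounded \<Omega>" and smooth: "C_infinity_boundary \<Omega>"
    unfolding smooth_bounded_domain_def by auto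
  from assms(3) obtain c where zero: "0 \<in> \<Omega>"
    and quad: "\<And>f. f \<in> A_infinity \<Omega> \<Longrightarrow>
      (LINT z:\<Omega>|lborel. f z * complex_of_real (cmod z ^ (2 * p))) = c * f 0"
    unfolding one_point_quadrature_domain_def by auto
  have "frontier \<Omega> \<noteq> {}"
    using zero bd by (auto simp: frontier_eq_empty)
  then obtain a where a: "a \<in> frontier \<Omega>" and amin: "\<And>y. y \<in> frontier \<Omega> \<Longrightarrow> cmod a \<le> cmod y"
    using distance_attains_inf[of "frontier \<Omega>" 0] by (auto simp: dist_norm)
  have a_notin: "a \<notin> \<Omega>" using a op by (simp add: frontier_def interior_open)
  define r where "r = cmod a"
  have r: "r > 0" using a_notin zero by (auto simp: r_def)
  \<comment> \<open>Otherwise the connected disc would meet the frontier at a point closer to 0 than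
    \<open>a\<close>.\<close>
  have ball_sub: "ball 0 r \<subseteq> \<Omega>"
  proof (rule ccontr)
    assume "\<not> ball 0 r \<subseteq> \<Omega>"
    moreover have "0 \<in> ball 0 r \<inter> \<Omega>" using zero r by simp
    ultimately have "ball 0 r \<inter> frontier \<Omega> \<noteq> {}"
      by (intro connected_Int_frontier connected_ball) blast+
    then show False using amin by (force simp: r_def)
  qed
  from smooth a obtain U and \<rho> :: "complex \<Rightarrow> real" and u where U: "open U" "a \<in> U"
    and \<rho>: "C_infinity_on U \<rho>" "\<rho> a = 0" "dir_deriv u \<rho> a \<noteq> 0" "\<Omega> \<inter> U = {z\<in>U. \<rho> z < 0}"
    unfolding C_infinity_boundary_def by blast
  have diff: "\<rho> differentiable (at z)" if "z \<in> U" for z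
    using \<rho>(1) that unfolding C_infinity_on_def by (metis empty_subsetI fold_simps(1) list.set(1))
  then have "continuous_on U \<rho>"
    by (meson continuous_at_imp_continuous_on differentiable_imp_continuous_within)
  moreover have "(\<rho> has_derivative frechet_derivative \<rho> (at a)) (at a)"
    using diff[OF U(2)] by (simp add: frechet_derivative_works)
  ultimately obtain v K t0 where K: "K > 0" and t0: "t0 > 0"
    and ext: "\<And>t. 0 < t \<Longrightarrow> t < t0 \<Longrightarrow> a + t *\<^sub>R v \<notin> closure \<Omega>"
    and cone: "\<And>t z. 0 < t \<Longrightarrow> t < t0 \<Longrightarrow> z \<in> \<Omega> \<Longrightarrow> cmod (z - a) \<le> K * cmod (z - (a + t *\<^sub>R v))"
    using exterior_approach[OF U _ _ \<rho>(2) _ \<rho>(4), of _ u] \<rho>(3) unfolding dir_deriv_def by metis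
  define D where "D = \<Omega> - ball 0 r"
  have D: "bounded D" "D \<in> sets borel" "D \<subseteq> \<Omega>"
    using bd op by (auto simp: D_def intro: bounded_subset)
  define h where "h = (\<lambda>w z. z / (z - w) * complex_of_real (cmod z ^ (2 * p)))"
  have meas [measurable]: "h w \<in> borel_measurable borel" for w
    unfolding h_def by measurable
  have exterior: "(LINT z:D|lborel. h w z) = 0" if w: "w \<notin> closure \<Omega>" for w
  proof -
    \<comment> \<open>Passing to closures yields the strict inequality \<open>cmod w > r\<close>
      that the kernel integral over the disc requires.\<close>
    have "cball 0 r \<subseteq> closure \<Omega>"
      using closure_mono[OF ball_sub] r by simp
    then have wr: "cmod w > r" using w by force
    have "(\<lambda>z. z / (z - w)) \<in> A_infinity \<Omega>"
      using w by (intro A_infinity_holomorphic_on[of "- {w}"]) (auto intro!: holomorphic_intros)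
    \<comment> \<open>The test function vanishes at the node 0, so the unknown constant
      \<open>c\<close> drops out.\<close>
    from quad[OF this] have "(LINT z:\<Omega>|lborel. h w z) = 0" by (simp add: h_def)
    moreover have "continuous_on (closure \<Omega>) (h w)"
      unfolding h_def using w by (intro continuous_intros) auto
    then have int: "set_integrable lborel \<Omega> (h w)"
      using bd op by (intro set_integrable_lborel_continuous) auto
    have "set_integrable lborel (ball 0 r) (h w)" "set_integrable lborel D (h w)"
      by (rule set_integrable_subset[OF int]; use ball_sub D in simp)+
    then have "(LINT z:ball 0 r \<union> D|lborel. h w z) = (LINT z:ball 0 r|lborel. h w z) + (LINT z:D|lborel. h w z)"
      by (intro set_integral_Un) (auto simp: D_def)
    moreover have "ball 0 r \<union> D = \<Omega>" using ball_sub by (auto simp: D_def)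
    moreover have "(LINT z:ball 0 r|lborel. h w z) = 0"
      unfolding h_def by (rule set_integral_ball_kernel_eq_0[OF r wr])
    ultimately show ?thesis by simp
  qed
  \<comment> \<open>The shift by two makes the factor at most \<open>1 / 2\<close>, hence
    \<open>t n < t0\<close> already for \<open>n = 0\<close>.\<close>
  define t where "t = (\<lambda>n. t0 * inverse (real (Suc (Suc n))))"
  define w where "w = (\<lambda>n. a + t n *\<^sub>R v)"
  have t: "0 < t n" "t n < t0" for n
    using t0 by (auto simp: t_def field_simps add_pos_nonneg)
  have "t \<longlonglongrightarrow> 0"
    unfolding t_def by (rule tendsto_mult_right_zero[OF LIMSEQ_Suc[OF LIMSEQ_inverse_real_of_nat]])
  then have "w \<longlonglongrightarrow> a + 0 *\<^sub>R v"
    unfolding w_def by (intro tendsto_intros)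
  then have w_lim: "w \<longlonglongrightarrow> a" by simp
  obtain M where M: "\<And>z. z \<in> \<Omega> \<Longrightarrow> cmod z \<le> M" using bd by (auto simp: bounded_iff)
  \<comment> \<open>Integrable majorant uniform in \<open>n\<close>: the numerator \<open>z\<close>
    and the weight together give the exponent \<open>Suc (2 * p)\<close>, and the cone estimate
    costs the factor \<open>K\<close>.\<close>
  define b where "b = (\<lambda>z. indicator D z *\<^sub>R (M ^ Suc (2 * p) * K * (1 / cmod (z - a))))"
  have "set_integrable lborel D (\<lambda>z. M ^ Suc (2 * p) * K * (1 / cmod (z - a)))"
    by (rule set_integrable_mult_right) (rule set_integrable_inverse_norm_complex[OF D(1,2)])
  then have b: "integrable lborel b"
    unfolding b_def set_integrable_def .
  have lim: "(\<lambda>n. indicator D z *\<^sub>R h (w n) z) \<longlonglongrightarrow> indicator D z *\<^sub>R h a z" for z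
  proof (cases "z \<in> D")
    case True
    then have "z - a \<noteq> 0" using a_notin D(3) by auto
    then show ?thesis unfolding h_def by (intro tendsto_intros w_lim)
  qed auto
  have dom: "norm (indicator D z *\<^sub>R h (w n) z) \<le> b z" for n z
  proof (cases "z \<in> D")
    case True
    then have z: "z \<in> \<Omega>" using D by auto
    then have za: "cmod (z - a) > 0" using a_notin by auto
    have 1: "cmod (z - a) \<le> K * cmod (z - w n)" unfolding w_def using cone[OF t z] .
    with za K have "cmod (z - w n) > 0" by (smt (verit) mult_nonneg_nonpos norm_ge_zero)
    with 1 za have 2: "1 / cmod (z - w n) \<le> K * (1 / cmod (z - a))" by (simp add: field_simps)
    have "cmod (h (w n) z) = cmod z ^ Suc (2 * p) * (1 / cmod (z - w n))"
      by (simp add: h_def norm_mult norm_divide norm_power)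
    also have "\<dots> \<le> M ^ Suc (2 * p) * (K * (1 / cmod (z - a)))"
      using 2 M[OF z] order_trans[OF norm_ge_zero M[OF z]] by (intro mult_mono power_mono) auto
    finally show ?thesis using True by (simp add: b_def mult.assoc)
  qed (simp add: b_def)
  have Dm: "(\<lambda>z. indicator D z *\<^sub>R h w z) \<in> borel_measurable lborel" for w
    using D(2) by measurable
  have "integrable lborel (\<lambda>z. indicator D z *\<^sub>R h a z)"
    by (rule integrable_dominated_convergence[OF Dm Dm b AE_I2 AE_I2]) (rule lim dom)+
  then have int_a: "set_integrable lborel D (h a)" unfolding set_integrable_def .
  have "(\<lambda>n. LINT z:D|lborel. h (w n) z) \<longlonglongrightarrow> (LINT z:D|lborel. h a z)"
    unfolding set_lebesgue_integral_def
    by (rule integral_dominated_convergence[OF Dm Dm b AE_I2 AE_I2]) (rule lim dom)+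
  moreover have "(LINT z:D|lborel. h (w n) z) = 0" for n
    unfolding w_def by (rule exterior[OF ext[OF t]])
  ultimately have "(LINT z:D|lborel. h a z) = 0"
    by (simp add: LIMSEQ_const_iff)
  then have Re_zero: "(LINT z:D|lborel. Re (h a z)) = 0"
    using integral_bounded_linear[OF bounded_linear_Re int_a[unfolded set_integrable_def]]
    by (simp add: set_lebesgue_integral_def)
  have Re_int: "set_integrable lborel D (\<lambda>z. Re (h a z))"
    using integrable_bounded_linear[OF bounded_linear_Re int_a[unfolded set_integrable_def]]
    by (simp add: set_integrable_def)
  \<comment> \<open>Outside the disc the kernel has real part at least \<open>1 / 2\<close> and the
    weight is at least \<open>r ^ (2 * p)\<close>.\<close>
  let ?k = "r ^ (2 * p) / 2"
  have "(LINT z:D|lborel. ?k) \<le> (LINT z:D|lborel. Re (h a z))"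
  proof (rule set_integral_mono[OF _ Re_int])
    show "set_integrable lborel D (\<lambda>z. ?k)"
      using D by (intro set_integrable_lborel_continuous continuous_intros) auto
    fix z assume z: "z \<in> D"
    then have "r \<le> cmod z" by (simp add: D_def)
    moreover have "z \<noteq> a" using z a_notin D(3) by auto
    ultimately have "1 / 2 * r ^ (2 * p) \<le> Re (z / (z - a)) * cmod z ^ (2 * p)"
      using r by (intro mult_mono power_mono order_trans[OF _ Re_kernel_ge_half]) (auto simp: r_def)
    moreover have "Re (h a z) = Re (z / (z - a)) * cmod z ^ (2 * p)"
      by (simp only: h_def times_complex.sel Re_complex_of_real Im_complex_of_real mult_zero_right diff_zero)
    ultimately show "?k \<le> Re (h a z)" by simp
  qed
  moreover have "(LINT z:D|lborel. ?k) = measure lborel D * ?k"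
    unfolding set_lebesgue_integral_def using D(2) emeasure_bounded_finite[OF D(1)] by simp
  ultimately have "measure lborel D * ?k \<le> 0" using Re_zero by simp
  moreover have "?k > 0" using r by simp
  ultimately have "measure lborel D \<le> 0" by (metis mult_pos_pos not_less)
  \<comment> \<open>Removing the closed disc leaves an open set, so measure zero forces it to be
    empty; openness of \<open>\<Omega>\<close> then replaces the closed disc by its
    interior.\<close>
  moreover have "open (\<Omega> - cball 0 r)" "\<Omega> - cball 0 r \<subseteq> D"
    using op by (auto simp: D_def)
  ultimately have "\<Omega> - cball 0 r = {}"
    using measure_lborel_pos[OF D(1,2)] by (metis not_less)
  then have "\<Omega> \<subseteq> interior (cball 0 r)" using op by (intro interior_maximal) auto
  then show ?thesis using ball_sub r by (auto simp: interior_cball)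
qed

end
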